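(* Let $G$ be a graph of order $n \geq 6$, and let $\overline{G}$ be its complement. Then $$8 \leq b_{\rm g}'(G)\, b_{\rm g}'(\overline{G}) \leq 3n-6.$$
   Context: All graphs are finite, simple and undirected; the order of a graph is its number of vertices. The burning game on a graph $G$ is played by two players, Burner and Staller, in rounds $t=1,2,3,\dots$. Initially (round $0$) all vertices are unburned. Each round $t\ge 1$ consists of two phases: first, in the spreading phase, every unburned vertex having a burning neighbor starts to burn (fire spreads simultaneously, by distance one, from all burning vertices); then, in the selection phase, if unburned vertices remain, the player whose turn it is chooses one unburned vertex, which starts to burn. Burning vertices stay burning forever. The players alternate: one of them selects in the odd rounds, the other in the even rounds. The game ends in the first round in which all vertices of $G$ are burning (possibly already after the spreading phase of that round). Burner wants to minimize the number of rounds and Staller wants to maximize it. If both play optimally, the number of rounds is denoted $b_{\rm g}'(G)$ (the Staller-start game burning number) when Staller makes the first move (selects in round 1). *)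

theory Defs
  imports "Graph_Theory.Pair_Digraph"
begin

text \<open>
  Finite simple undirected graphs are the instances of the locale \<open>pair_graph\<close>:
  each edge is represented by its two opposite arcs.
\<close>

definition complement :: "'a pair_pre_digraph \<Rightarrow> 'a pair_pre_digraph" where
  "complement G = \<lparr> pverts = pverts G,
     parcs = {(u, v). u \<in> pverts G \<and> v \<in> pverts G \<and> u \<noteq> v \<and> (u, v) \<notin> parcs G} \<rparr>"

lemma pair_graph_complement:
  assumes "pair_graph G"
  shows "pair_graph (complement G)"
proof -
  interpret pair_graph G by fact
  have sym: "(u, v) \<in> parcs G \<Longrightarrow> (v, u) \<in> parcs G" for u v
    using pair_sym_arcs by (auto simp: symmetric_def sym_def)
  have "parcs (complement G) \<subseteq> pverts G \<times> pverts G"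
    by (auto simp: complement_def)
  then have "finite (parcs (complement G))"
    using pair_finite_verts by (meson finite_SigmaI finite_subset)
  then show ?thesis
    using pair_finite_verts sym
    by unfold_locales (auto simp: complement_def symmetric_def sym_def)
qed

datatype player = Burner | Staller

fun opponent :: "player \<Rightarrow> player" where
  "opponent Burner = Staller"
| "opponent Staller = Burner"

definition spread :: "'a pair_pre_digraph \<Rightarrow> 'a set \<Rightarrow> 'a set" where
  "spread G B = B \<union> {v \<in> pverts G. \<exists>u \<in> B. (u, v) \<in> parcs G}"

text \<open>
  \<open>rounds_left G p B\<close> is the number of rounds still to be played, under optimal play,
  when the set of burning vertices is \<open>B\<close> at the beginning of a round in which \<open>p\<close> has
  the turn to select. The round in which everything burns is counted even if this
  happens in its spreading phase, so that nothing is left to be selected.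
  The value for infinite vertex sets is a dummy, needed for termination only.
\<close>

function rounds_left :: "'a pair_pre_digraph \<Rightarrow> player \<Rightarrow> 'a set \<Rightarrow> nat" where
  "rounds_left G p B =
    (if infinite (pverts G) \<or> pverts G \<subseteq> B then 0
     else if pverts G \<subseteq> spread G B then 1
     else (let values = (\<lambda>v. rounds_left G (opponent p) (insert v (spread G B)))
                          ` (pverts G - spread G B)
           in 1 + (case p of Burner \<Rightarrow> Min values | Staller \<Rightarrow> Max values)))"
  by pat_completeness auto
termination
proof (relation "measure (\<lambda>(G, p, B). card (pverts G - B))")
  show "((G, opponent p, insert v (spread G B)), G, p, B)
      \<in> measure (\<lambda>(G, p, B). card (pverts G - B))"
    if "\<not> (infinite (pverts G) \<or> pverts G \<subseteq> B)" "v \<in> pverts G - spread G B"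
    for G :: "'a pair_pre_digraph" and p B v
  proof -
    have "pverts G - insert v (spread G B) \<subset> pverts G - B"
      using that by (auto simp: spread_def)
    then have "card (pverts G - insert v (spread G B)) < card (pverts G - B)"
      using that by (intro psubset_card_mono) auto
    then show ?thesis by simp
  qed
qed auto

declare rounds_left.simps [simp del]

definition staller_start_burning_number :: "'a pair_pre_digraph \<Rightarrow> nat" where
  "staller_start_burning_number G = rounds_left G Staller {}"

end

theory Submission
  imports Defs
begin

text \<open>
  The bounds rest on the first three rounds of the game. If \<open>G\<close> has no vertex of degree at least
  two, then the complement burns in two rounds, while \<open>G\<close> itself needs at least four (and at most
  \<open>n\<close>). If \<open>G\<close> has such a vertex, Burner can use it (or the spread from Staller's first vertex)
  to have four vertices burning in the spreading phase of round 3, so that \<open>n - 2\<close> rounds suffice.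
  It remains to consider the case that both numbers are at least 4. Then, in \<open>G\<close> and in its
  complement, some vertex has at least three vertices at distance at least 3. These two vertices
  and their two sets of far vertices are disjoint, so \<open>n \<ge> 8\<close>. Moreover two vertices at distance
  at least 3 form a dominating edge of the complement, so both numbers are at most 4, and
  \<open>16 \<le> 3 * n - 6\<close>.
\<close>

section \<open>Bounds on the number of rounds\<close>

lemma spread_mono: "A \<subseteq> B \<Longrightarrow> spread G A \<subseteq> spread G B"
  by (auto simp: spread_def)

lemma spread_increasing: "B \<subseteq> spread G B"
  by (auto simp: spread_def)

lemma spread_empty [simp]: "spread G {} = {}"
  by (auto simp: spread_def)

lemma spread_insert: "spread G (insert v B) = spread G {v} \<union> spread G B"
  by (auto simp: spread_def)

lemma spread_subset: "B \<subseteq> pverts G \<Longrightarrow> spread G B \<subseteq> pverts G"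
  by (auto simp: spread_def)

lemma rounds_left_eq_0: "pverts G \<subseteq> B \<Longrightarrow> rounds_left G p B = 0"
  by (simp add: rounds_left.simps)

lemma rounds_left_spread_all: "pverts G \<subseteq> spread G B \<Longrightarrow> rounds_left G p B \<le> 1"
  by (simp add: rounds_left.simps)

text \<open>A minimum or maximum over finitely many continuations is the value of one of them, so
  one rule serves both players.\<close>

lemma rounds_left_le_Suc:
  assumes "finite (pverts G)"
    and "\<And>v. v \<in> pverts G - spread G B \<Longrightarrow>
      rounds_left G (opponent p) (insert v (spread G B)) \<le> k"
  shows "rounds_left G p B \<le> Suc k"
proof (cases "pverts G \<subseteq> spread G B")
  case True
  then show ?thesis
    using rounds_left_spread_all[of G B p] by linarith
next
  case False
  let ?values = "(\<lambda>v. rounds_left G (opponent p) (insert v (spread G B)))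
    ` (pverts G - spread G B)"
  have fin_ne: "finite ?values" "?values \<noteq> {}"
    using assms(1) False by auto
  have le: "x \<le> k" if "x \<in> ?values" for x
    using that assms(2) by auto
  have "Min ?values \<le> k" "Max ?values \<le> k"
    using Min_in[OF fin_ne] Max_in[OF fin_ne] le by blast+
  then show ?thesis
    using le by (cases p; subst rounds_left.simps) (auto simp: Let_def)
qed

lemma rounds_left_Burner_le:
  assumes "finite (pverts G)" "v \<in> pverts G - spread G B"
  shows "rounds_left G Burner B \<le> Suc (rounds_left G Staller (insert v (spread G B)))"
proof -
  have "Min ((\<lambda>v. rounds_left G Staller (insert v (spread G B))) ` (pverts G - spread G B))
    \<le> rounds_left G Staller (insert v (spread G B))"
    using assms by (intro Min_le) auto
  then show ?thesis
    by (subst rounds_left.simps) (auto simp: Let_def)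
qed

lemma rounds_left_Burner_ge:
  assumes "finite (pverts G)" "\<not> pverts G \<subseteq> spread G B"
    and "\<And>v. v \<in> pverts G - spread G B \<Longrightarrow> k \<le> rounds_left G Staller (insert v (spread G B))"
  shows "Suc k \<le> rounds_left G Burner B"
proof -
  have "k \<le> Min ((\<lambda>v. rounds_left G Staller (insert v (spread G B))) ` (pverts G - spread G B))"
    using assms by (subst Min_ge_iff) auto
  moreover have "\<not> pverts G \<subseteq> B"
    using assms(2) spread_increasing[of B G] by blast
  ultimately show ?thesis
    using assms by (subst rounds_left.simps) (auto simp: Let_def)
qed

lemma rounds_left_Staller_ge:
  assumes "finite (pverts G)" "v \<in> pverts G - spread G B"
  shows "Suc (rounds_left G Burner (insert v (spread G B))) \<le> rounds_left G Staller B"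
proof -
  have "rounds_left G Burner (insert v (spread G B))
    \<le> Max ((\<lambda>v. rounds_left G Burner (insert v (spread G B))) ` (pverts G - spread G B))"
    using assms by (intro Max_ge) auto
  moreover have "\<not> pverts G \<subseteq> B"
    using assms(2) spread_increasing[of B G] by blast
  ultimately show ?thesis
    using assms by (subst (2) rounds_left.simps) (auto simp: Let_def)
qed

lemma rounds_left_pos:
  assumes "finite (pverts G)" "\<not> pverts G \<subseteq> B"
  shows "1 \<le> rounds_left G p B"
  using assms by (subst rounds_left.simps) (auto simp: Let_def)

text \<open>Whoever selects, every round sets at least one new vertex on fire.\<close>

lemma rounds_left_le_card:
  assumes "finite (pverts G)"
  shows "rounds_left G p B \<le> card (pverts G - B)"
proof (induction "card (pverts G - B)" arbitrary: p B rule: less_induct)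
  case less
  show ?case
  proof (cases "pverts G \<subseteq> B")
    case True
    then show ?thesis by (simp add: rounds_left_eq_0)
  next
    case False
    then have pos: "card (pverts G - B) > 0"
      using assms by (auto simp: card_gt_0_iff)
    have "rounds_left G p B \<le> Suc (card (pverts G - B) - 1)"
    proof (rule rounds_left_le_Suc[OF assms])
      fix v assume "v \<in> pverts G - spread G B"
      then have "pverts G - insert v (spread G B) \<subset> pverts G - B"
        using spread_increasing[of B G] by blast
      then have "card (pverts G - insert v (spread G B)) < card (pverts G - B)"
        using assms by (intro psubset_card_mono) auto
      then show "rounds_left G (opponent p) (insert v (spread G B)) \<le> card (pverts G - B) - 1"
        using less[of "insert v (spread G B)" "opponent p"] by linarith
    qed
    then show ?thesis using pos by linarith
  qed
qed

text \<open>The selection already uses up one vertex left by the spreading phase, and each later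
  round at least one more. The \<open>max 1\<close> pays for the present round when spreading alone
  finishes, since that round is counted too.\<close>

lemma rounds_left_le_card_spread:
  assumes "finite (pverts G)"
  shows "rounds_left G p B \<le> max 1 (card (pverts G - spread G B))"
proof -
  have "rounds_left G p B \<le> Suc (card (pverts G - spread G B) - 1)"
  proof (rule rounds_left_le_Suc[OF assms])
    fix v assume "v \<in> pverts G - spread G B"
    then have "card (pverts G - insert v (spread G B)) = card (pverts G - spread G B) - 1"
      using assms by (metis Diff_insert card_Diff_singleton)
    then show "rounds_left G (opponent p) (insert v (spread G B))
        \<le> card (pverts G - spread G B) - 1"
      using rounds_left_le_card[OF assms] by metis
  qed
  then show ?thesis by linarith
qed

lemma funpow_spread_mono: "A \<subseteq> B \<Longrightarrow> (spread G ^^ k) A \<subseteq> (spread G ^^ k) B"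
  by (induction k) (auto dest: spread_mono)

text \<open>Selections only enlarge the burning set and \<open>spread\<close> is monotone, so fire
  left to itself is the slowest case.\<close>

lemma rounds_left_le_funpow:
  assumes "finite (pverts G)" "pverts G \<subseteq> (spread G ^^ k) B"
  shows "rounds_left G p B \<le> k"
  using assms(2)
proof (induction k arbitrary: p B)
  case 0
  then show ?case by (simp add: rounds_left_eq_0)
next
  case (Suc k)
  show ?case
  proof (rule rounds_left_le_Suc[OF assms(1)])
    fix v
    have "(spread G ^^ k) (spread G B) \<subseteq> (spread G ^^ k) (insert v (spread G B))"
      by (rule funpow_spread_mono) auto
    then have "pverts G \<subseteq> (spread G ^^ k) (insert v (spread G B))"
      using Suc.prems by (simp add: funpow_swap1)
    then show "rounds_left G (opponent p) (insert v (spread G B)) \<le> k"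
      by (rule Suc.IH)
  qed
qed

section \<open>Staller's opening move and games of at most two rounds\<close>

lemma staller_start_le_Suc:
  assumes "finite (pverts G)" "\<And>v. v \<in> pverts G \<Longrightarrow> rounds_left G Burner {v} \<le> k"
  shows "staller_start_burning_number G \<le> Suc k"
  unfolding staller_start_burning_number_def
  using assms by (intro rounds_left_le_Suc) auto

lemma staller_start_ge_Suc:
  assumes "finite (pverts G)" "v \<in> pverts G"
  shows "Suc (rounds_left G Burner {v}) \<le> staller_start_burning_number G"
  using rounds_left_Staller_ge[of G v "{}"] assms
  by (simp add: staller_start_burning_number_def)

lemma staller_start_le_card:
  "finite (pverts G) \<Longrightarrow> staller_start_burning_number G \<le> card (pverts G)"
  using rounds_left_le_card[of G Staller "{}"] by (simp add: staller_start_burning_number_def)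

lemma staller_start_ge_2:
  assumes "finite (pverts G)" "card (pverts G) \<ge> 2"
  shows "2 \<le> staller_start_burning_number G"
proof -
  obtain v where v: "v \<in> pverts G"
    using assms by fastforce
  have "\<not> pverts G \<subseteq> {v}"
    using assms card_mono[of "{v}" "pverts G"] by auto
  then show ?thesis
    using rounds_left_pos[OF assms(1)] staller_start_ge_Suc[OF assms(1) v]
    by (metis Suc_1 Suc_le_mono le_trans One_nat_def)
qed

text \<open>In round 2 Burner selects the only vertex that the spread may have left. The converse is
  \<open>staller_start_le_2D\<close>.\<close>

lemma staller_start_le_2I:
  assumes "finite (pverts G)" "\<And>v. v \<in> pverts G \<Longrightarrow> card (pverts G - spread G {v}) \<le> 1"
  shows "staller_start_burning_number G \<le> 2"
proof -
  have "rounds_left G Burner {v} \<le> 1" if "v \<in> pverts G" for v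
    using rounds_left_le_card_spread[OF assms(1), of Burner "{v}"] assms(2)[OF that] by linarith
  then show ?thesis
    using staller_start_le_Suc[OF assms(1), of 1] by simp
qed

lemma staller_start_le_2D:
  assumes "finite (pverts G)" "v \<in> pverts G" "staller_start_burning_number G \<le> 2"
  shows "card (pverts G - spread G {v}) \<le> 1"
proof (rule ccontr)
  assume large: "\<not> ?thesis"
  have "Suc 1 \<le> rounds_left G Burner {v}"
  proof (rule rounds_left_Burner_ge[OF assms(1)])
    show "\<not> pverts G \<subseteq> spread G {v}"
      using large by (metis Diff_eq_empty_iff card.empty zero_le)
    fix w
    \<comment> \<open>At least two vertices survive the spread, so Burner's choice \<open>w\<close>
      leaves one unburned.\<close>
    have "\<not> pverts G - spread G {v} \<subseteq> {w}"
      using large card_mono[of "{w}" "pverts G - spread G {v}"] by auto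
    then have "\<not> pverts G \<subseteq> insert w (spread G {v})"
      by blast
    then show "1 \<le> rounds_left G Staller (insert w (spread G {v}))"
      by (rule rounds_left_pos[OF assms(1)])
  qed
  then show False
    using staller_start_ge_Suc[OF assms(1,2)] assms(3) by linarith
qed

section \<open>Graphs with and without a vertex of degree two\<close>

lemma parcs_sym:
  assumes "pair_graph G" "(u, v) \<in> parcs G"
  shows "(v, u) \<in> parcs G"
proof -
  interpret pair_graph G by fact
  show ?thesis
    using assms(2) pair_sym_arcs by (auto simp: symmetric_def sym_def)
qed

text \<open>Components have at most two vertices, so fire never leaves the components of the
  selected vertices. After the selection of round 3 at most 2 + 2 + 1 = 5 vertices burn, fewer than
  6.\<close>

lemma staller_start_ge_4:
  assumes "pair_graph G" "card (pverts G) \<ge> 6"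
    and deg: "\<And>u a b. (u, a) \<in> parcs G \<Longrightarrow> (u, b) \<in> parcs G \<Longrightarrow> a = b"
  shows "4 \<le> staller_start_burning_number G"
proof -
  interpret pair_graph G by fact
  note sym = parcs_sym[OF assms(1)]
  have nbhd: "finite (spread G {u}) \<and> card (spread G {u}) \<le> 2" for u
  proof (cases "\<exists>a. (u, a) \<in> parcs G")
    case True
    then obtain a where "(u, a) \<in> parcs G" by blast
    then have "spread G {u} \<subseteq> {u, a}"
      using deg by (auto simp: spread_def)
    moreover have "card {u, a} \<le> 2"
      by (simp add: card_insert_if)
    ultimately show ?thesis
      by (meson card_mono finite.emptyI finite_insert finite_subset le_trans)
  next
    case False
    then have "spread G {u} = {u}"
      by (auto simp: spread_def)
    then show ?thesis by simp
  qed
  have idem: "spread G (spread G {u}) = spread G {u}" for u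
    using deg sym by (fastforce simp: spread_def)
  obtain v where v: "v \<in> pverts G"
    using assms(2) by fastforce
  have not_all: "\<not> pverts G \<subseteq> B" if "finite B" "card B \<le> 5" for B
    using that assms(2) card_mono[of B "pverts G"] by auto
  have "Suc 2 \<le> rounds_left G Burner {v}"
  proof (rule rounds_left_Burner_ge)
    show "\<not> pverts G \<subseteq> spread G {v}"
      using nbhd[of v] by (intro not_all) auto
    fix w
    let ?B = "spread G (insert w (spread G {v}))"
    have B: "?B = spread G {w} \<union> spread G {v}"
      by (subst spread_insert) (simp add: idem)
    have fin: "finite ?B" and card: "card ?B \<le> 4"
      using nbhd[of v] nbhd[of w] card_Un_le[of "spread G {w}" "spread G {v}"]
      unfolding B by auto
    obtain x where x: "x \<in> pverts G - ?B"
      using not_all[OF fin] card by auto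
    have "card (insert x ?B) \<le> 5"
      using fin card by (simp add: card_insert_if)
    then have "1 \<le> rounds_left G Burner (insert x ?B)"
      using fin by (intro rounds_left_pos not_all) auto
    then show "2 \<le> rounds_left G Staller (insert w (spread G {v}))"
      using rounds_left_Staller_ge[OF _ x] by simp
  qed simp
  then show ?thesis
    using staller_start_ge_Suc[OF _ v] by simp
qed

text \<open>Two rounds precede the spreading phase of round 3, which leaves at most n - 4 vertices
  unburned; counting round 3, at most n - 4 rounds follow. An order of at least 5 keeps n - 4
  positive, so the \<open>max 1\<close> in \<open>rounds_left_le_card_spread\<close> is
  harmless.\<close>

lemma staller_start_le_minus_2:
  assumes "pair_graph G" "card (pverts G) \<ge> 5"
    and u: "(u, a) \<in> parcs G" "(u, b) \<in> parcs G" "a \<noteq> b"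
  shows "staller_start_burning_number G \<le> card (pverts G) - 2"
proof -
  interpret pair_graph G by fact
  note sym = parcs_sym[OF assms(1)]
  have uab: "{u, a, b} \<subseteq> pverts G" "u \<noteq> a" "u \<noteq> b"
    using u wellformed' no_loops' by fastforce+
  have "rounds_left G Burner {v} \<le> card (pverts G) - 3" if v: "v \<in> pverts G" for v
  proof (cases "pverts G \<subseteq> spread G {v}")
    case True
    then show ?thesis
      using rounds_left_spread_all[OF True, of Burner] assms(2) by linarith
  next
    case False
    have sub: "spread G (insert w (spread G {v})) \<subseteq> pverts G" if "w \<in> pverts G" for w
      using that v spread_subset[of _ G] by (meson empty_subsetI insert_subset)
    then have fin: "finite (spread G (insert w (spread G {v})))" if "w \<in> pverts G" for w
      using that finite_subset[OF sub pair_finite_verts] by blast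
    \<comment> \<open>Here \<open>v\<close> is Staller's opening and \<open>w\<close> Burner's
      reply, chosen according to whether the spread of round 2 has reached \<open>u\<close>.\<close>
    obtain w where w: "w \<in> pverts G - spread G {v}"
      and card: "4 \<le> card (spread G (insert w (spread G {v})))"
    proof (cases "u \<in> spread G {v}")
      \<comment> \<open>Spreading alone burns \<open>u\<close>, \<open>a\<close> and
        \<open>b\<close> by round 3, so the reply only has to add a fourth vertex, outside
        \<open>?S\<close> if there is one.\<close>
      case near: True
      let ?S = "spread G (spread G {v})"
      have S: "{u, a, b} \<subseteq> ?S"
        using near u uab by (auto simp: spread_def)
      have "?S \<subseteq> pverts G"
        using v spread_subset by (metis empty_subsetI insert_subset)
      then have fin_S: "finite ?S"
        by (rule finite_subset) simp
      have card_S: "3 \<le> card ?S"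
        using card_mono[OF fin_S S] u uab by simp
      show ?thesis
      proof (cases "pverts G \<subseteq> ?S")
        case True
        obtain w where w: "w \<in> pverts G - spread G {v}"
          using False by blast
        have "pverts G \<subseteq> spread G (insert w (spread G {v}))"
          using True spread_mono[of "spread G {v}" "insert w (spread G {v})" G] by blast
        then have "card (pverts G) \<le> card (spread G (insert w (spread G {v})))"
          using w by (intro card_mono fin) auto
        then have "4 \<le> card (spread G (insert w (spread G {v})))"
          using assms(2) by linarith
        then show ?thesis using w that by blast
      next
        case False
        then obtain w where w: "w \<in> pverts G" "w \<notin> ?S" by blast
        have "insert w ?S \<subseteq> spread G (insert w (spread G {v}))"
          by (auto simp: spread_def)
        from card_mono[OF fin this] have "4 \<le> card (spread G (insert w (spread G {v})))"
          using w card_S fin_S by simp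
        moreover have "w \<notin> spread G {v}"
          using w spread_increasing[of "spread G {v}" G] by blast
        ultimately show ?thesis using w that by blast
      qed
    next
      \<comment> \<open>Burner replies \<open>u\<close>, and \<open>a\<close>, \<open>b\<close> burn
        in round 3. The opening \<open>v\<close> differs from all three, as otherwise
        \<open>u\<close> would lie in \<open>spread G {v}\<close>.\<close>
      case far: False
      then have "v \<noteq> u" "v \<noteq> a" "v \<noteq> b"
        using u uab sym by (auto simp: spread_def)
      then have "card {v, u, a, b} = 4"
        using u uab by simp
      moreover have "{v, u, a, b} \<subseteq> spread G (insert u (spread G {v}))"
        using u uab by (auto simp: spread_def)
      ultimately have "4 \<le> card (spread G (insert u (spread G {v})))"
        using card_mono[OF fin] uab by (metis insert_subset)
      then show ?thesis using that far uab by blast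
    qed
    let ?B = "insert w (spread G {v})"
    have "card (pverts G - spread G ?B) = card (pverts G) - card (spread G ?B)"
      using w fin sub by (intro card_Diff_subset) auto
    then have "rounds_left G Staller ?B \<le> card (pverts G) - 4"
      using rounds_left_le_card_spread[of G Staller ?B] card assms(2) by simp
    then show ?thesis
      using rounds_left_Burner_le[OF _ w] assms(2) by fastforce
  qed
  then show ?thesis
    using staller_start_le_Suc[of G "card (pverts G) - 3"] assms(2) by simp
qed

section \<open>Complements and vertices at distance at least three\<close>

lemma pverts_complement [simp]: "pverts (complement G) = pverts G"
  by (simp add: complement_def)

lemma parcs_complement_iff:
  "(u, v) \<in> parcs (complement G) \<longleftrightarrow>
    u \<in> pverts G \<and> v \<in> pverts G \<and> u \<noteq> v \<and> (u, v) \<notin> parcs G"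
  by (simp add: complement_def)

lemma complement_complement:
  assumes "pair_graph G"
  shows "complement (complement G) = G"
proof -
  interpret pair_graph G by fact
  have "parcs (complement (complement G)) = parcs G"
    using wellformed' no_loops' by (fastforce simp: complement_def)
  then show ?thesis
    by (simp add: complement_def)
qed

text \<open>The vertices that \<open>v\<close> misses in one step of the complement are its
  neighbours in \<open>G\<close>.\<close>

lemma staller_start_complement_le_2:
  assumes "pair_graph G"
    and deg: "\<And>u a b. (u, a) \<in> parcs G \<Longrightarrow> (u, b) \<in> parcs G \<Longrightarrow> a = b"
  shows "staller_start_burning_number (complement G) \<le> 2"
proof (rule staller_start_le_2I)
  interpret pair_graph G by fact
  show "finite (pverts (complement G))" by simp
  fix v assume v: "v \<in> pverts (complement G)"
  let ?R = "pverts (complement G) - spread (complement G) {v}"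
  have "(v, x) \<in> parcs G" if "x \<in> ?R" for x
    using that v by (auto simp: spread_def parcs_complement_iff)
  then have "x = y" if "x \<in> ?R" "y \<in> ?R" for x y
    using that deg by blast
  then show "card ?R \<le> 1"
    by (auto simp: card_le_Suc0_iff_eq)
qed

text \<open>By \<open>staller_start_le_2D\<close> every vertex of \<open>G\<close> has at most one
  non-neighbour, so the complement has maximum degree at most one.\<close>

lemma staller_start_complement_ge_4:
  assumes "pair_graph G" "card (pverts G) \<ge> 6" "staller_start_burning_number G \<le> 2"
  shows "4 \<le> staller_start_burning_number (complement G)"
proof (rule staller_start_ge_4)
  interpret pair_graph G by fact
  show "pair_graph (complement G)"
    using assms(1) by (rule pair_graph_complement)
  show "6 \<le> card (pverts (complement G))"
    using assms(2) by simp
  fix u a b assume ua: "(u, a) \<in> parcs (complement G)" and ub: "(u, b) \<in> parcs (complement G)"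
  have "card (pverts G - spread G {u}) \<le> 1"
    using ua assms(3) by (intro staller_start_le_2D) (auto simp: parcs_complement_iff)
  moreover have "a \<in> pverts G - spread G {u}" "b \<in> pverts G - spread G {u}"
    using ua ub by (auto simp: spread_def parcs_complement_iff)
  ultimately show "a = b"
    by (auto simp: card_le_Suc0_iff_eq)
qed

text \<open>The vertices at distance at least three from \<open>v\<close>, other components
  included: those that fire from an opening at \<open>v\<close> has not reached in the spreading
  phase of round 3.\<close>

definition far :: "'a pair_pre_digraph \<Rightarrow> 'a \<Rightarrow> 'a set" where
  "far G v = pverts G - spread G (spread G {v})"

lemma mem_far_iff:
  assumes "pair_graph G" "v \<in> pverts G"
  shows "x \<in> far G v \<longleftrightarrow> x \<in> pverts G \<and> x \<noteq> v \<and> (v, x) \<notin> parcs G \<and>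
    (\<forall>y. (v, y) \<in> parcs G \<longrightarrow> (y, x) \<notin> parcs G)"
proof -
  interpret pair_graph G by fact
  show ?thesis
    using assms(2) wellformed' by (fastforce simp: far_def spread_def)
qed

text \<open>Staller has an opening \<open>v\<close> that forces four rounds. Whatever Burner
  replies, at least two vertices are unburned after the spread of round 3; these are far from
  \<open>v\<close> and differ from the reply.\<close>

lemma staller_start_ge_4_far:
  assumes "finite (pverts G)" "4 \<le> staller_start_burning_number G"
  obtains v where "v \<in> pverts G" "3 \<le> card (far G v)"
proof -
  obtain v where v: "v \<in> pverts G" and "\<not> rounds_left G Burner {v} \<le> 2"
    using staller_start_le_Suc[OF assms(1), of 2] assms(2) by force
  then have large: "2 < rounds_left G Burner {v}" by simp
  have "finite (far G v)"
    using assms(1) by (simp add: far_def)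
  have unburned: "2 \<le> card (far G v - {w})" if w: "w \<in> pverts G - spread G {v}" for w
  proof -
    have "1 < rounds_left G Staller (insert w (spread G {v}))"
      using rounds_left_Burner_le[OF assms(1) w] large by linarith
    then have "2 \<le> card (pverts G - spread G (insert w (spread G {v})))"
      using rounds_left_le_card_spread[OF assms(1), of Staller "insert w (spread G {v})"]
      by linarith
    also have "\<dots> \<le> card (far G v - {w})"
      using \<open>finite (far G v)\<close> by (intro card_mono) (auto simp: far_def spread_def)
    finally show ?thesis .
  qed
  have "\<not> pverts G \<subseteq> spread G {v}"
    using rounds_left_spread_all[of G "{v}" Burner] large by linarith
  then have "far G v \<noteq> {}"
    using unburned by fastforce
  \<comment> \<open>Against a reply \<open>r\<close> that is itself far, two more far vertices
    remain, which makes three.\<close>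
  then obtain r where r: "r \<in> far G v" by blast
  then have "r \<in> pverts G - spread G {v}"
    using spread_increasing[of "spread G {v}" G] by (auto simp: far_def)
  then have "3 \<le> card (far G v)"
    using unburned r \<open>finite (far G v)\<close> by fastforce
  with v show ?thesis by (rule that)
qed

text \<open>In \<open>G\<close> the vertices \<open>v\<close> and \<open>r\<close> are non-adjacent
  without common neighbour, so they form a dominating edge of the complement.\<close>

lemma staller_start_complement_le_4:
  assumes "pair_graph G" "v \<in> pverts G" "r \<in> far G v"
  shows "staller_start_burning_number (complement G) \<le> 4"
proof -
  interpret pair_graph G by fact
  note sym = parcs_sym[OF assms(1)]
  let ?s = "spread (complement G)"
  note r = iffD1[OF mem_far_iff[OF assms(1,2)] assms(3)]
  have edge: "(v, r) \<in> parcs (complement G)" "(r, v) \<in> parcs (complement G)"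
    using r assms(2) sym by (auto simp: parcs_complement_iff)
  have dom: "x = v \<or> x = r \<or> (v, x) \<in> parcs (complement G) \<or> (r, x) \<in> parcs (complement G)"
    if "x \<in> pverts G" for x
    using that r assms(2) sym by (auto simp: parcs_complement_iff)
  have dom': "x = v \<or> x = r \<or> (x, v) \<in> parcs (complement G) \<or> (x, r) \<in> parcs (complement G)"
    if "x \<in> pverts G" for x
    using that r assms(2) sym by (auto simp: parcs_complement_iff)
  have "rounds_left (complement G) Burner {x} \<le> 3" if x: "x \<in> pverts G" for x
  proof (rule rounds_left_le_funpow)
    \<comment> \<open>From any opening \<open>x\<close>, the first spread reaches an end of the
      dominating edge, the second both ends, the third everything.\<close>
    have "v \<in> ?s {x} \<or> r \<in> ?s {x}"
      using dom'[OF x] r assms(2) by (auto simp: spread_def)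
    then have "v \<in> ?s (?s {x})" "r \<in> ?s (?s {x})"
      using edge r assms(2) unfolding spread_def[of _ "?s {x}"] by auto
    then have "pverts G \<subseteq> ?s (?s (?s {x}))"
      using dom unfolding spread_def[of _ "?s (?s {x})"] by auto
    then show "pverts (complement G) \<subseteq> (?s ^^ 3) {x}"
      by (simp add: eval_nat_numeral)
  qed simp
  then show ?thesis
    using staller_start_le_Suc[of "complement G" 3] by simp
qed

text \<open>Each claim is refuted alike: its failure yields a path of length two in the complement
  from \<open>w\<close> to a vertex of \<open>far (complement G) w\<close>.\<close>

lemma far_complement_disjoint:
  assumes "pair_graph G" "v \<in> pverts G" "w \<in> pverts G"
    and ne: "far G v \<noteq> {}" "far (complement G) w \<noteq> {}"
  shows "v \<noteq> w" "w \<notin> far G v" "v \<notin> far (complement G) w"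
    "far G v \<inter> far (complement G) w = {}"
proof -
  interpret pair_graph G by fact
  note sym = parcs_sym[OF assms(1)]
  have "w \<in> pverts (complement G)" using assms(3) by simp
  note far = mem_far_iff[OF assms(1,2)]
    mem_far_iff[OF pair_graph_complement[OF assms(1)] this]
  obtain r s where r: "r \<in> far G v" and s: "s \<in> far (complement G) w"
    using ne by blast
  note rs = iffD1[OF far(1) r] iffD1[OF far(2) s]
  have co_arc: "(x, y) \<in> parcs (complement G)"
    if "x \<in> pverts G" "y \<in> pverts G" "x \<noteq> y" "(x, y) \<notin> parcs G" for x y
    using that by (simp add: parcs_complement_iff)
  \<comment> \<open>Far in the complement implies non-adjacent there, hence adjacent in
    \<open>G\<close>.\<close>
  have ws: "s \<in> pverts G" "s \<noteq> w" "(w, s) \<in> parcs G" "(s, w) \<in> parcs G"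
    using rs(2) assms(3) co_arc sym by auto
  show "v \<noteq> w"
  proof
    \<comment> \<open>The path is \<open>w\<close>, \<open>r\<close>, \<open>s\<close>: an edge
      \<open>r\<close>-\<open>s\<close> of \<open>G\<close> would put \<open>r\<close> at distance
      two from \<open>v\<close>.\<close>
    assume "v = w"
    with ws rs(1) have "(r, s) \<notin> parcs G" "r \<noteq> s"
      using sym by blast+
    then have "(w, r) \<in> parcs (complement G)" "(r, s) \<in> parcs (complement G)"
      using \<open>v = w\<close> ws(1) rs(1) assms(3) by (auto intro!: co_arc)
    then show False using rs(2) by blast
  qed
  show "w \<notin> far G v"
  proof
    \<comment> \<open>The path is \<open>w\<close>, \<open>v\<close>, \<open>s\<close>: an edge
      \<open>v\<close>-\<open>s\<close> of \<open>G\<close> would put \<open>w\<close> at distance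
      two from \<open>v\<close>.\<close>
    assume "w \<in> far G v"
    note vw = iffD1[OF far(1) this]
    then have "(v, s) \<notin> parcs G" "v \<noteq> s" "(w, v) \<notin> parcs G"
      using ws sym by blast+
    then have "(w, v) \<in> parcs (complement G)" "(v, s) \<in> parcs (complement G)"
      using vw ws(1) assms(2,3) by (auto intro!: co_arc)
    then show False using rs(2) by blast
  qed
  show "v \<notin> far (complement G) w"
  proof
    \<comment> \<open>The path is \<open>w\<close>, \<open>r\<close>, \<open>v\<close>: in
      \<open>G\<close>, \<open>w\<close> is a neighbour of \<open>v\<close> and hence not of
      \<open>r\<close>.\<close>
    assume "v \<in> far (complement G) w"
    note wv = iffD1[OF far(2) this]
    then have "(w, v) \<in> parcs G"
      using co_arc assms(2,3) by blast
    then have "(w, r) \<notin> parcs G" "w \<noteq> r" "(r, v) \<notin> parcs G"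
      using rs(1) sym by blast+
    then have "(w, r) \<in> parcs (complement G)" "(r, v) \<in> parcs (complement G)"
      using rs(1) assms(2,3) by (auto intro!: co_arc)
    then show False using wv by blast
  qed
  show "far G v \<inter> far (complement G) w = {}"
  proof (rule equals0I)
    fix x assume "x \<in> far G v \<inter> far (complement G) w"
    then have x: "x \<in> far G v" "x \<in> far (complement G) w" by auto
    note vx = iffD1[OF far(1) x(1)] and wx = iffD1[OF far(2) x(2)]
    \<comment> \<open>The path is \<open>w\<close>, \<open>v\<close>, \<open>x\<close>: in
      \<open>G\<close>, \<open>w\<close> is a neighbour of \<open>x\<close> and hence not of
      \<open>v\<close>.\<close>
    have "(w, x) \<in> parcs G"
      using vx wx co_arc assms(3) by blast
    then have "(w, v) \<notin> parcs G" "w \<noteq> v"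
      using vx sym by blast+
    then have "(w, v) \<in> parcs (complement G)" "(v, x) \<in> parcs (complement G)"
      using vx assms(2,3) by (auto intro!: co_arc)
    then show False using wx by blast
  qed
qed

lemma staller_start_both_ge_4:
  assumes "pair_graph G" "4 \<le> staller_start_burning_number G"
    "4 \<le> staller_start_burning_number (complement G)"
  shows "8 \<le> card (pverts G)" "staller_start_burning_number G \<le> 4"
    "staller_start_burning_number (complement G) \<le> 4"
proof -
  interpret pair_graph G by fact
  note co = pair_graph_complement[OF assms(1)]
  obtain v where v: "v \<in> pverts G" "3 \<le> card (far G v)"
    using assms staller_start_ge_4_far[of G] by auto
  obtain w where w: "w \<in> pverts G" "3 \<le> card (far (complement G) w)"
    using assms staller_start_ge_4_far[of "complement G"] by auto
  have ne: "far G v \<noteq> {}" "far (complement G) w \<noteq> {}"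
    using v w by auto
  then obtain r s where r: "r \<in> far G v" and s: "s \<in> far (complement G) w" by blast
  show "staller_start_burning_number (complement G) \<le> 4"
    using staller_start_complement_le_4[OF assms(1) v(1) r] .
  \<comment> \<open>The dominating edge of \<open>G\<close> comes from the far pair
    \<open>w\<close>, \<open>s\<close> of its complement.\<close>
  show "staller_start_burning_number G \<le> 4"
    using staller_start_complement_le_4[OF co _ s] w complement_complement[OF assms(1)] by simp
  note disj = far_complement_disjoint[OF assms(1) v(1) w(1) ne]
  have sub: "far G v \<subseteq> pverts G" "far (complement G) w \<subseteq> pverts G"
    by (auto simp: far_def)
  then have fin: "finite (far G v)" "finite (far (complement G) w)"
    using finite_subset[OF _ pair_finite_verts] by blast+
  have "v \<notin> far G v" "w \<notin> far (complement G) w"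
    by (auto simp: far_def spread_def)
  then have "card (insert v (insert w (far G v \<union> far (complement G) w)))
      = 2 + card (far G v) + card (far (complement G) w)"
    using disj fin by (simp add: card_Un_disjoint)
  moreover have "card (insert v (insert w (far G v \<union> far (complement G) w))) \<le> card (pverts G)"
    using sub v(1) w(1) by (intro card_mono) auto
  ultimately show "8 \<le> card (pverts G)"
    using v(2) w(2) by linarith
qed

section \<open>The bounds on the product\<close>

lemma staller_start_product_le_if_small:
  assumes "pair_graph G" "card (pverts G) \<ge> 6"
    and deg: "\<And>u a b. (u, a) \<in> parcs G \<Longrightarrow> (u, b) \<in> parcs G \<Longrightarrow> a = b"
  shows "staller_start_burning_number G * staller_start_burning_number (complement G)
    \<le> 3 * card (pverts G) - 6"
proof -
  interpret pair_graph G by fact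
  have "staller_start_burning_number G * staller_start_burning_number (complement G)
    \<le> card (pverts G) * 2"
    using staller_start_le_card[of G] staller_start_complement_le_2[OF assms(1) deg]
    by (intro mult_le_mono) auto
  \<comment> \<open>With n for the order, n >= 6 gives 2 * n <= 3 * n - 6.\<close>
  then show ?thesis using assms(2) by linarith
qed

theorem theorem14:
  fixes G :: "'a pair_pre_digraph" and n :: nat
  assumes "pair_graph G"
    and "card (pverts G) = n"
    and "n \<ge> 6"
  shows "8 \<le> staller_start_burning_number G * staller_start_burning_number (complement G)
    \<and> staller_start_burning_number G * staller_start_burning_number (complement G) \<le> 3 * n - 6"
proof
  interpret pair_graph G by fact
  let ?b = "staller_start_burning_number G" and ?c = "staller_start_burning_number (complement G)"
  note co = pair_graph_complement[OF assms(1)] and coco = complement_complement[OF assms(1)]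
  have n: "card (pverts G) \<ge> 6" "card (pverts (complement G)) \<ge> 6"
    using assms by auto
  have ge2: "2 \<le> ?b" "2 \<le> ?c"
    using staller_start_ge_2[of G] staller_start_ge_2[of "complement G"] n by auto
  have ge4: "?b \<le> 2 \<Longrightarrow> 4 \<le> ?c" "?c \<le> 2 \<Longrightarrow> 4 \<le> ?b"
    using staller_start_complement_ge_4[OF assms(1) n(1)]
      staller_start_complement_ge_4[OF co n(2)] coco by auto
  \<comment> \<open>A factor 2 forces the other to be at least 4; otherwise both are at least 3 and
    the product is at least 9.\<close>
  consider "2 \<le> ?b \<and> 4 \<le> ?c" | "4 \<le> ?b \<and> 2 \<le> ?c" | "3 \<le> ?b \<and> 3 \<le> ?c"
    using ge2 ge4 by linarith
  then show "8 \<le> ?b * ?c"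
  proof cases
    case 1
    then have "2 * 4 \<le> ?b * ?c" by (intro mult_le_mono) auto
    then show ?thesis by simp
  next
    case 2
    then have "4 * 2 \<le> ?b * ?c" by (intro mult_le_mono) auto
    then show ?thesis by simp
  next
    case 3
    then have "3 * 3 \<le> ?b * ?c" by (intro mult_le_mono) auto
    then show ?thesis by simp
  qed
  \<comment> \<open>For graphs, \<open>?small\<close> means maximum degree at most one.\<close>
  let ?small = "\<lambda>H :: 'a pair_pre_digraph.
    \<forall>u a b. (u, a) \<in> parcs H \<longrightarrow> (u, b) \<in> parcs H \<longrightarrow> a = b"
  show "?b * ?c \<le> 3 * n - 6"
  proof (cases "?small G \<or> ?small (complement G)")
    case True
    then show ?thesis
    proof
      assume "?small G"
      then show ?thesis
        using staller_start_product_le_if_small[OF assms(1) n(1)] unfolding assms(2) by metis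
    next
      assume "?small (complement G)"
      then have "?c * ?b \<le> 3 * n - 6"
        using staller_start_product_le_if_small[OF co n(2)]
        unfolding coco pverts_complement assms(2) by metis
      then show ?thesis by (simp add: mult.commute)
    qed
  next
    case False
    then obtain u a b u' a' b'
      where u: "(u, a) \<in> parcs G" "(u, b) \<in> parcs G" "a \<noteq> b"
        and u': "(u', a') \<in> parcs (complement G)" "(u', b') \<in> parcs (complement G)" "a' \<noteq> b'"
      by blast
    have le: "?b \<le> n - 2" "?c \<le> n - 2"
      using staller_start_le_minus_2[OF assms(1) _ u] staller_start_le_minus_2[OF co _ u']
        n assms(2) by auto
    \<comment> \<open>A factor at most 3, together with the bound n - 2 on the other, gives 3 * (n -
      2), which is the claim.\<close>
    consider "?b \<le> 3" | "?c \<le> 3" | "4 \<le> ?b" "4 \<le> ?c" by linarith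
    then show ?thesis
    proof cases
      case 1
      then have "?b * ?c \<le> 3 * (n - 2)" using le by (intro mult_le_mono)
      then show ?thesis by simp
    next
      case 2
      then have "?b * ?c \<le> (n - 2) * 3" using le by (intro mult_le_mono)
      then show ?thesis by simp
    next
      case 3
      note both = staller_start_both_ge_4[OF assms(1) 3]
      have "?b * ?c \<le> 4 * 4" using both by (intro mult_le_mono)
      \<comment> \<open>Here n >= 8, so 3 * n - 6 >= 18 > 16.\<close>
      then show ?thesis using both(1) assms(2) by linarith
    qed
  qed
qed

end
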